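(* Let $p<q$ be odd prime numbers, and let $\boldsymbol{a}_{pq}$ be the binary cyclotomic word. (1) If $q\equiv 1 \pmod p$ and $\boldsymbol{v}_i=0^i(-1)0^{p-i-2}1$ for each $i\in\{0,\dots,p-2\}$, then $$\boldsymbol{a}_{pq}=1\,\boldsymbol{v}_0^{\lfloor q/p\rfloor}\boldsymbol{v}_1^{\lfloor q/p\rfloor}\boldsymbol{v}_2^{\lfloor q/p\rfloor}\cdots\boldsymbol{v}_{p-3}^{\lfloor q/p\rfloor}\boldsymbol{v}_{p-2}^{\lfloor q/p\rfloor}.$$ (2) If $q\equiv p-1\pmod p$ and $\boldsymbol{v}_i=0^{p-i-2}1\,0^i(-1)$ for each $i\in\{0,\dots,p-2\}$, then $$\boldsymbol{a}_{pq}=1(-1)\,\boldsymbol{v}_0^{\lfloor q/p\rfloor}\boldsymbol{v}_1^{\lfloor q/p\rfloor+1}\boldsymbol{v}_2^{\lfloor q/p\rfloor+1}\cdots\boldsymbol{v}_{p-3}^{\lfloor q/p\rfloor+1}\boldsymbol{v}_{p-2}^{\lfloor q/p\rfloor}\,1,$$ that is, the exponent of $\boldsymbol{v}_i$ is $\lfloor q/p\rfloor$ for $i\in\{0,p-2\}$ and $\lfloor q/p\rfloor+1$ for $1\le i\le p-3$ (for $p=3$ the product is $\boldsymbol{v}_0^{\lfloor q/3\rfloor}\boldsymbol{v}_1^{\lfloor q/3\rfloor}$).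
   Context: Words are over the alphabet $\mathcal{A}=\{-1,0,1\}$; juxtaposition is concatenation, $\boldsymbol{u}^s$ is the $s$-fold concatenation of $\boldsymbol{u}$ with itself, $0^s$ is the word of $s$ zeros, and $0^0$ is the empty word. The binary cyclotomic word $\boldsymbol{a}_{pq}\in\mathcal{A}^{m+1}$, $m=(p-1)(q-1)$, is the word whose letters are the coefficients of the cyclotomic polynomial $\Phi_{pq}$: its letter in position $j$ (positions start at $0$) is the coefficient of $X^j$ in $\Phi_{pq}$. *)

theory Defs
  imports
    Complex_Main
    "HOL-Computational_Algebra.Polynomial"
    "HOL-Number_Theory.Cong"
begin

definition primitive_unity_root :: "nat \<Rightarrow> complex \<Rightarrow> bool" where
  "primitive_unity_root n z \<longleftrightarrow> n > 0 \<and> z ^ n = 1 \<and> (\<forall>k. 0 < k \<and> k < n \<longrightarrow> z ^ k \<noteq> 1)"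

definition cyclotomic_poly :: "nat \<Rightarrow> complex poly" where
  "cyclotomic_poly n = (\<Prod>z | primitive_unity_root n z. [:- z, 1:])"

text \<open>
  Words are lists. Since the coefficients of the cyclotomic polynomial are taken in the field over
  which it is defined, the letters -1, 0, 1 are complex numbers; an equation between words
  therefore includes the fact that the coefficients are integers.
\<close>

definition binary_cyclotomic_word :: "nat \<Rightarrow> nat \<Rightarrow> complex list" where
  "binary_cyclotomic_word p q =
     map (\<lambda>j. coeff (cyclotomic_poly (p * q)) j) [0..<(p - 1) * (q - 1) + 1]"

definition word_power :: "'a list \<Rightarrow> nat \<Rightarrow> 'a list"  (infixr "\<^bold>^" 80) where
  "u \<^bold>^ s = concat (replicate s u)"

end

theory Submission
  imports Defs
    "HOL-Computational_Algebra.Fundamental_Theorem_Algebra"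
begin

text \<open>
  For primes \<open>p \<noteq> q\<close> the cyclotomic polynomial is determined by
  \<open>\<Phi> (X^p - 1) (X^q - 1) = (X^(pq) - 1) (X - 1)\<close>
  (\<open>cyclotomic_poly_prime_mult\<close>). Hence a word of length \<open>(p - 1)(q - 1) + 1\<close> is the cyclotomic word
  as soon as its generating polynomial satisfies this equation (\<open>binary_cyclotomic_word_eqI\<close>), and
  the theorem becomes a computation with the polynomials of the words on the right-hand sides.

  The computation succeeds because every block \<open>v i\<close> has length \<open>p\<close>: multiplication by \<open>X^p - 1\<close>
  collapses a power of a block to its two ends (\<open>Poly_concat_word_powers\<close>). If every block is repeated
  \<open>s\<close> times, then the product becomes \<open>X^(p s) - 1\<close> times the sum of the \<open>X^(i p s) Poly (v i)\<close>.
  The polynomial of \<open>v i\<close> is \<open>X^(p - 1) - X^i\<close> in the first case and \<open>X^(p - 2 - i) - X^(p - 1)\<close> in the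
  second, so this sum splits into two geometric sums. In one of them the ratio is \<open>X^(p s)\<close>,
  and it is summed by the factor \<open>X^(p s) - 1\<close> already there. In the other one the exponent \<open>\<plusminus>i\<close>
  turns the ratio into \<open>X^q\<close>, since \<open>p s\<close> is \<open>q - 1\<close> in the first case and \<open>q + 1\<close> in the second; it is
  summed by the factor \<open>X^q - 1\<close>.

  In the second case the exponents are not all equal, but this is only a boundary effect. The word
  begins with \<open>1 (-1)\<close>, the last two letters of \<open>v 0 = 0^(p - 2) 1 (-1)\<close>, and it ends with \<open>1\<close>, the first
  letter of \<open>v (p - 2) = 1 0^(p - 2) (-1)\<close>. Completing these two blocks by \<open>0^(p - 2)\<close> on the left and
  by \<open>0^(p - 2) (-1)\<close> on the right gives a word in which every block occurs \<open>q div p + 1\<close> times.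
\<close>

section \<open>The binary cyclotomic polynomial\<close>

abbreviation X :: "'a::comm_ring_1 poly" where
  "X \<equiv> [:0, 1:]"

lemma unity_root_gcd:
  fixes z :: "'a::comm_ring_1"
  assumes "z ^ a = 1" and "z ^ b = 1"
  shows "z ^ gcd a b = 1"
proof (cases "a = 0")
  case True
  then show ?thesis using assms by simp
next
  case False
  then obtain x y where "a * x = b * y + gcd a b"
    using bezout_nat by blast
  then have "(z ^ a) ^ x = (z ^ b) ^ y * z ^ gcd a b"
    by (metis power_add power_mult)
  then show ?thesis using assms by simp
qed

text \<open>
  The polynomial \<open>X^n - 1\<close> is separable, since its derivative has no root other than 0, and 0 is not a root
  of \<open>X^n - 1\<close>.
\<close>

lemma prod_unity_roots:
  assumes "n > 0"
  shows "(\<Prod>z | z ^ n = 1. [:- z, 1:]) = X ^ n - (1 :: complex poly)"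
proof -
  let ?f = "monom 1 n - 1 :: complex poly"
  have roots: "poly ?f z = z ^ n - 1" for z
    by (simp add: poly_monom)
  have "rsquarefree ?f"
    unfolding rsquarefree_roots roots
    using assms by (auto simp: pderiv_diff pderiv_monom poly_monom power_0_left)
  moreover have "lead_coeff ?f = 1"
  proof -
    have "degree ?f = n"
      using degree_add_eq_left[of "-1" "monom (1 :: complex) n"] assms
      by (simp add: degree_monom_eq)
    then show ?thesis using assms by simp
  qed
  ultimately have "(\<Prod>z | z ^ n = 1. [:- z, 1:]) = ?f"
    using complex_poly_decompose_rsquarefree[of ?f] unfolding roots by simp
  then show ?thesis by (simp add: monom_altdef)
qed

text \<open>
  If \<open>z^(p q) = 1\<close> and \<open>z^k = 1\<close> with \<open>0 < k < p q\<close>, then \<open>z^d = 1\<close> for \<open>d = gcd k (p q)\<close>. This is a proper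
  divisor of \<open>p q\<close>, and such a divisor divides one of the two primes.
\<close>

lemma primitive_unity_root_prime_mult:
  assumes "prime p" "prime q"
  shows "primitive_unity_root (p * q) z \<longleftrightarrow> z ^ (p * q) = 1 \<and> z ^ p \<noteq> 1 \<and> z ^ q \<noteq> 1"
    (is "?L \<longleftrightarrow> ?R")
proof
  have gt: "p > 1" "q > 1"
    using assms prime_gt_1_nat by auto
  show ?R if ?L
    using that gt unfolding primitive_unity_root_def by auto
  show ?L if R: ?R
  proof (rule ccontr)
    assume "\<not> ?L"
    then obtain k where k: "0 < k" "k < p * q" "z ^ k = 1"
      using R gt unfolding primitive_unity_root_def by auto
    define d where "d = gcd k (p * q)"
    have zd: "z ^ d = 1"
      unfolding d_def using k R by (intro unity_root_gcd) auto
    have "d \<le> k" using k by (simp add: d_def gcd_le1_nat)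
    then have less: "d < p * q" using k by simp
    have dvd: "d dvd p * q" by (simp add: d_def)
    have "d dvd p \<or> d dvd q"
    proof (cases "p dvd d")
      case True
      then obtain e where e: "d = p * e" by blast
      then have "e dvd q" using dvd gt by simp
      then have "e = 1" using assms less e by (auto simp: prime_nat_iff)
      then show ?thesis using e by simp
    next
      case False
      then have "coprime d p"
        using assms by (metis coprime_commute prime_imp_coprime)
      then show ?thesis using dvd by (simp add: coprime_dvd_mult_right_iff)
    qed
    then show False
      using zd R by (metis dvdE power_mult power_one)
  qed
qed

text \<open>
  Compare linear factors: among the \<open>p q\<close>-th roots of unity, the non-primitive ones are the union of the \<open>p\<close>-th and the
  \<open>q\<close>-th roots of unity, and these two sets share only the root 1.
\<close>

lemma cyclotomic_poly_prime_mult: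
  assumes "prime p" "prime q" "p \<noteq> q"
  shows "cyclotomic_poly (p * q) * ((X ^ p - 1) * (X ^ q - 1)) = (X ^ (p * q) - 1) * (X - 1)"
proof -
  let ?U = "\<lambda>n. {z :: complex. z ^ n = 1}" and ?g = "\<lambda>z :: complex. [:- z, 1:]"
  let ?P = "{z. primitive_unity_root (p * q) z}"
  have pos: "p > 0" "q > 0"
    using assms by (simp_all add: prime_gt_0_nat)
  have fin: "finite (?U n)" if "n > 0" for n
    using that by (intro finite_roots_unity) simp
  have P: "?P = ?U (p * q) - (?U p \<union> ?U q)"
    using primitive_unity_root_prime_mult[OF assms(1,2)] by auto
  have "coprime p q"
    using assms by (simp add: primes_coprime)
  then have int: "?U p \<inter> ?U q = {1}"
    using unity_root_gcd[of _ p q] by auto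
  have sub: "?U p \<union> ?U q \<subseteq> ?U (p * q)"
    by (auto simp: power_mult) (metis mult.commute power_mult power_one)
  have "cyclotomic_poly (p * q) * ((X ^ p - 1) * (X ^ q - 1)) = prod ?g ?P * (prod ?g (?U p) * prod ?g (?U q))"
    by (simp add: cyclotomic_poly_def prod_unity_roots pos)
  also have "prod ?g (?U p) * prod ?g (?U q) = prod ?g (?U p \<union> ?U q) * prod ?g (?U p \<inter> ?U q)"
    using pos by (intro prod.union_inter [symmetric] fin)
  also have "prod ?g ?P * (prod ?g (?U p \<union> ?U q) * prod ?g (?U p \<inter> ?U q)) = prod ?g (?U (p * q)) * (X - 1)"
  proof -
    have "prod ?g (?U (p * q)) = prod ?g ?P * prod ?g (?U p \<union> ?U q)"
      unfolding P using pos by (intro prod.subset_diff sub fin) simp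
    moreover have "prod ?g (?U p \<inter> ?U q) = X - 1"
      unfolding int by (simp add: one_pCons)
    ultimately show ?thesis by (simp only: mult.assoc)
  qed
  also have "prod ?g (?U (p * q)) = X ^ (p * q) - 1"
    using pos by (intro prod_unity_roots) simp
  finally show ?thesis .
qed

lemma power_X_minus_1_nonzero:
  assumes "n > 0"
  shows "X ^ n - 1 \<noteq> (0 :: 'a::idom poly)"
proof
  assume "X ^ n - 1 = (0 :: 'a poly)"
  then have "poly (X ^ n - 1) (0 :: 'a) = 0" by simp
  then show False using assms by (simp add: power_0_left)
qed

lemma binary_cyclotomic_word_eqI:
  assumes "prime p" "prime q" "p \<noteq> q"
    and len: "length w = (p - 1) * (q - 1) + 1"
    and w: "Poly w * ((X ^ p - 1) * (X ^ q - 1)) = (X ^ (p * q) - 1) * (X - 1)"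
  shows "binary_cyclotomic_word p q = w"
proof -
  have "(X ^ p - 1) * (X ^ q - 1) \<noteq> (0 :: complex poly)"
    using assms power_X_minus_1_nonzero by (metis mult_eq_0_iff prime_gt_0_nat)
  then have "cyclotomic_poly (p * q) = Poly w"
    using w cyclotomic_poly_prime_mult[OF assms(1-3)] by (metis mult_right_cancel)
  then show ?thesis
    unfolding binary_cyclotomic_word_def
    by (intro nth_equalityI) (auto simp: len nth_default_nth simp del: upt_Suc)
qed

section \<open>Generating polynomials of periodic words\<close>

lemma word_power_0 [simp]: "u \<^bold>^ 0 = []"
  by (simp add: word_power_def)

lemma word_power_Suc [simp]: "u \<^bold>^ Suc s = u @ u \<^bold>^ s"
  by (simp add: word_power_def)

lemma word_power_Suc_right: "u \<^bold>^ Suc s = u \<^bold>^ s @ u"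
  by (induction s) simp_all

lemma word_power_single: "[a] \<^bold>^ s = replicate s a"
  by (induction s) simp_all

lemma length_word_power [simp]: "length (u \<^bold>^ s) = s * length u"
  by (induction s) simp_all

lemma Poly_append_X: "Poly (u @ w) = Poly u + X ^ length u * Poly w"
  by (simp add: Poly_append monom_altdef)

lemma Poly_word_power:
  "Poly (u \<^bold>^ s) * (X ^ length u - 1) = (X ^ (length u * s) - 1) * Poly u"
proof (induction s)
  case (Suc s)
  have "Poly (u \<^bold>^ Suc s) * (X ^ length u - 1) =
      Poly u * (X ^ length u - 1) + X ^ length u * (Poly (u \<^bold>^ s) * (X ^ length u - 1))"
    by (simp only: word_power_Suc Poly_append_X) (simp add: algebra_simps)
  also have "\<dots> = (X ^ (length u * Suc s) - 1) * Poly u"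
    by (simp only: Suc) (simp add: algebra_simps power_add)
  finally show ?case .
qed simp

lemma length_concat_word_powers:
  assumes "\<And>i. i < n \<Longrightarrow> length (v i) = p"
  shows "length (concat (map (\<lambda>i. v i \<^bold>^ s) [0..<n])) = n * (p * s)"
  using assms by (induction n) (simp_all add: algebra_simps)

text \<open>
  The polynomial of a power \<open>u^s\<close> is \<open>Poly u\<close> times a geometric sum of ratio \<open>X^(length u)\<close>. For blocks
  of equal length \<open>p\<close>, one multiplication by \<open>X^p - 1\<close> therefore sums all the powers at once.
\<close>

lemma Poly_concat_word_powers:
  assumes "\<And>i. i < n \<Longrightarrow> length (v i) = p"
  shows "Poly (concat (map (\<lambda>i. v i \<^bold>^ s) [0..<n])) * (X ^ p - 1) =
    (X ^ (p * s) - 1) * (\<Sum>i<n. X ^ (i * (p * s)) * Poly (v i))"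
  using assms
proof (induction n)
  case (Suc n)
  let ?C = "concat (map (\<lambda>i. v i \<^bold>^ s) [0..<n])"
  have len: "length ?C = n * (p * s)"
    using Suc.prems by (intro length_concat_word_powers) simp
  have "concat (map (\<lambda>i. v i \<^bold>^ s) [0..<Suc n]) = ?C @ v n \<^bold>^ s"
    by simp
  then have "Poly (concat (map (\<lambda>i. v i \<^bold>^ s) [0..<Suc n])) * (X ^ p - 1) =
      Poly ?C * (X ^ p - 1) + X ^ (n * (p * s)) * (Poly (v n \<^bold>^ s) * (X ^ p - 1))"
    by (simp only: Poly_append_X len) (simp add: algebra_simps)
  also have "Poly (v n \<^bold>^ s) * (X ^ p - 1) = (X ^ (p * s) - 1) * Poly (v n)"
    using Poly_word_power[of "v n" s] Suc.prems by simp
  also have "Poly ?C * (X ^ p - 1) = (X ^ (p * s) - 1) * (\<Sum>i<n. X ^ (i * (p * s)) * Poly (v i))"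
    using Suc by simp
  finally show ?case by (simp add: algebra_simps)
qed simp

lemma geometric_sum_powers:
  fixes x :: "'a::comm_ring_1"
  shows "(\<Sum>i<n. x ^ (i * m)) * (x ^ m - 1) = x ^ (n * m) - 1"
  using power_diff_1_eq[of "x ^ m" n] by (simp add: mult.commute flip: power_mult)

section \<open>The two residue classes\<close>

text \<open>
  Here \<open>p (q div p) = q - 1\<close>, and \<open>(q - 1) i + i = q i\<close> produces the geometric sum of ratio \<open>X^q\<close>.
\<close>

lemma binary_cyclotomic_word_cong_1:
  fixes p q :: nat
  defines "v \<equiv> \<lambda>i. [0] \<^bold>^ i @ [-1] @ [0] \<^bold>^ (p - i - 2) @ [1]"
  assumes "prime p" "prime q" "p < q" "[q = 1] (mod p)"
  shows "binary_cyclotomic_word p q = [1] @ concat (map (\<lambda>i. v i \<^bold>^ (q div p)) [0..<p - 1])"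
proof (rule binary_cyclotomic_word_eqI)
  let ?C = "concat (map (\<lambda>i. v i \<^bold>^ (q div p)) [0..<p - 1])"
  have p: "p \<ge> 2" using assms by (simp add: prime_ge_2_nat)
  have "q mod p = 1" using assms p by (simp add: cong_def)
  then have k: "p * (q div p) = q - 1" by (metis minus_mod_eq_mult_div)
  have len: "length (v i) = p" if "i < p - 1" for i
    using that by (simp add: v_def)
  have Pv: "Poly (v i) = X ^ (p - 1) - X ^ i" if "i < p - 1" for i
  proof -
    have "p - 1 = i + Suc (p - i - 2)" using that by simp
    then have "(X :: complex poly) ^ (p - 1) = X ^ i * (X * X ^ (p - i - 2))"
      by (simp only: power_add power_Suc)
    moreover have "Poly (v i) = X ^ i * (X * X ^ (p - i - 2)) - X ^ i"
      by (simp add: v_def word_power_single Poly_append_X algebra_simps)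
    ultimately show ?thesis by simp
  qed
  show "length ([1] @ ?C) = (p - 1) * (q - 1) + 1"
    using length_concat_word_powers[of "p - 1" v p, OF len] k by simp
  \<comment> \<open>With names for the independent powers, the final identity is one between
      polynomials in the four indeterminates \<open>X, P, Q, T\<close>.\<close>
  define P Q T :: "complex poly"
    where "P = X ^ (p - 1)" and "Q = X ^ (q - 1)" and "T = X ^ ((p - 1) * (q - 1))"
  have exps: "p = Suc (p - 1)" "q = Suc (q - 1)" "(p - 1) * q = (p - 1) * (q - 1) + (p - 1)"
      "p * q = q + (p - 1) * q"
    using p \<open>p < q\<close> by (cases p; cases q; simp add: algebra_simps)+
  have Xp: "X ^ p = X * P" and Xq: "X ^ q = X * Q" and Xpq1: "X ^ ((p - 1) * q) = T * P"
    and Xpq: "X ^ (p * q) = X * Q * (T * P)"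
    unfolding P_def Q_def T_def by (metis exps power_Suc power_add)+
  define G where "G = (\<Sum>i<p - 1. X ^ (i * q) :: complex poly)"
  have G: "G * (X * Q - 1) = T * P - 1"
    unfolding G_def using geometric_sum_powers[of "X :: complex poly" q "p - 1"] unfolding Xq Xpq1 .
  have "Poly ?C * (X * P - 1) = (Q - 1) * (\<Sum>i<p - 1. X ^ (i * (q - 1)) * Poly (v i))"
    using Poly_concat_word_powers[of "p - 1" v p, OF len] k Xp by (simp add: Q_def)
  also have "(\<Sum>i<p - 1. X ^ (i * (q - 1)) * Poly (v i)) =
      (\<Sum>i<p - 1. P * X ^ (i * (q - 1)) - X ^ (i * q))"
  proof (rule sum.cong)
    fix i assume "i \<in> {..<p - 1}"
    moreover have "i * q = i * (q - 1) + i" using exps(2) by (metis add.commute mult_Suc_right)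
    then have "X ^ (i * q) = X ^ (i * (q - 1)) * X ^ i" by (simp only: power_add)
    ultimately show "X ^ (i * (q - 1)) * Poly (v i) = P * X ^ (i * (q - 1)) - X ^ (i * q)"
      by (simp add: Pv P_def algebra_simps)
  qed simp
  also have "(Q - 1) * \<dots> = P * ((\<Sum>i<p - 1. X ^ (i * (q - 1))) * (Q - 1)) - (Q - 1) * G"
    by (simp add: sum_subtractf sum_distrib_left G_def algebra_simps)
  also have "(\<Sum>i<p - 1. X ^ (i * (q - 1))) * (Q - 1) = T - 1"
    unfolding Q_def T_def by (rule geometric_sum_powers)
  finally have C: "Poly ?C * (X * P - 1) = P * (T - 1) - (Q - 1) * G" .
  have W: "Poly ([1] @ ?C) = 1 + X * Poly ?C"
    by (simp only: Poly_append_X) (simp add: one_pCons)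
  have "Poly ([1] @ ?C) * ((X ^ p - 1) * (X ^ q - 1)) =
      ((X * P - 1) + X * (Poly ?C * (X * P - 1))) * (X * Q - 1)"
    unfolding W Xp Xq by algebra
  also have "\<dots> = ((X * P - 1) + X * (P * (T - 1))) * (X * Q - 1) - X * (Q - 1) * (G * (X * Q - 1))"
    unfolding C by algebra
  also have "\<dots> = (X ^ (p * q) - 1) * (X - 1)"
    unfolding G Xpq by algebra
  finally show "Poly ([1] @ ?C) * ((X ^ p - 1) * (X ^ q - 1)) = (X ^ (p * q) - 1) * (X - 1)" .
qed (use assms in auto)

text \<open>
  Here \<open>p (q div p + 1) = q + 1\<close>, and \<open>(q + 1) i + (p - i - 2) = (p - 2) + q i\<close> produces the geometric sum
  of ratio \<open>X^q\<close>. The zeros that complete the first block shift the word by \<open>p - 2\<close>, so everything is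
  computed up to the factor \<open>X^(p - 2)\<close>, which is cancelled at the end.
\<close>

lemma binary_cyclotomic_word_cong_minus_1:
  fixes p q :: nat
  defines "v \<equiv> \<lambda>i. [0] \<^bold>^ (p - i - 2) @ [1] @ [0] \<^bold>^ i @ [-1]"
  assumes "prime p" "prime q" "odd p" "p < q" "[q = p - 1] (mod p)"
  shows "binary_cyclotomic_word p q =
    [1, -1] @
    concat (map (\<lambda>i. v i \<^bold>^ (if i = 0 \<or> i = p - 2 then q div p else q div p + 1)) [0..<p - 1])
    @ [1]" (is "_ = ?W")
proof (rule binary_cyclotomic_word_eqI)
  let ?e = "\<lambda>i. if i = 0 \<or> i = p - 2 then q div p else q div p + 1"
  let ?C = "concat (map (\<lambda>i. v i \<^bold>^ (q div p + 1)) [0..<p - 1])"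
  let ?M = "concat (map (\<lambda>i. v i \<^bold>^ (q div p + 1)) [1..<p - 2])"
  have p: "p \<ge> 3"
    using assms by (metis One_nat_def Suc_1 Suc_leI numeral_3_eq_3 prime_ge_2_nat even_numeral le_neq_implies_less)
  have "q mod p = p - 1" using assms p by (simp add: cong_def)
  then have "p * (q div p) = q - (p - 1)" by (metis minus_mod_eq_mult_div)
  then have k: "p * (q div p + 1) = q + 1" using p \<open>p < q\<close> by simp
  have len: "length (v i) = p" if "i < p - 1" for i
    using that by (simp add: v_def)
  have lenC: "length ?C = (p - 1) * (q + 1)"
    using length_concat_word_powers[of "p - 1" v p "q div p + 1", OF len] unfolding k .
  have split: "[0..<p - 1] = 0 # [1..<p - 2] @ [p - 2]"
  proof -
    have "p - 1 = Suc (p - 2)" using p by simp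
    then show ?thesis using p by (simp add: upt_conv_Cons)
  qed
  have mid: "map (\<lambda>i. v i \<^bold>^ ?e i) [1..<p - 2] = map (\<lambda>i. v i \<^bold>^ (q div p + 1)) [1..<p - 2]"
    by (intro map_cong) auto
  have W: "?W = [1, -1] @ v 0 \<^bold>^ (q div p) @ ?M @ v (p - 2) \<^bold>^ (q div p) @ [1]"
    unfolding split
    by (simp only: list.map map_append concat.simps concat_append mid append_assoc append_Nil
        append_Nil2 simp_thms if_True)
  have "?C = v 0 \<^bold>^ Suc (q div p) @ ?M @ v (p - 2) \<^bold>^ Suc (q div p)"
    unfolding split by (simp del: upt_Suc word_power_Suc)
  then have C: "?C = (v 0 @ v 0 \<^bold>^ (q div p)) @ ?M @ v (p - 2) \<^bold>^ (q div p) @ v (p - 2)"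
    by (simp only: word_power_Suc[of "v 0"] word_power_Suc_right[of "v (p - 2)"])
  have ends: "v 0 = [0] \<^bold>^ (p - 2) @ [1, -1]" "v (p - 2) = [1] @ [0] \<^bold>^ (p - 2) @ [-1]"
    by (simp_all add: v_def numeral_2_eq_2)
  \<comment> \<open>Both incomplete blocks at the ends of the word are completed.\<close>
  have pad: "[0] \<^bold>^ (p - 2) @ ?W @ [0] \<^bold>^ (p - 2) @ [-1] = ?C"
    unfolding W C by (simp add: ends)
  have exps: "p = Suc (Suc (p - 2))" "p - 1 = Suc (p - 2)" "p * q = q + (p - 1) * q"
      "(p - 1) * (q + 1) = (p - 1) * q + (p - 1)"
    using p by (simp_all add: algebra_simps)
  have "length ?C = 2 * (p - 2) + length ?W + 1"
    unfolding pad[symmetric] by simp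
  then have lenW: "2 * (p - 2) + length ?W + 1 = (p - 1) * (q + 1)"
    using lenC by simp
  also have "\<dots> = (p - 1) * (q - 1) + 2 * (p - 1)"
    using p \<open>p < q\<close> by (cases p; cases q; simp add: algebra_simps)
  finally show "length ?W = (p - 1) * (q - 1) + 1" using exps(2) by linarith
  \<comment> \<open>The position of the final letter \<open>-1\<close> of the completed word.\<close>
  have pos: "(p - 2) + length ?W + (p - 2) = (p - 1) * q + (p - 2)"
    using lenW exps by linarith
  define P Q U :: "complex poly"
    where "P = X ^ (p - 2)" and "Q = X ^ q" and "U = X ^ ((p - 1) * q)"
  have P0: "P \<noteq> 0"
    by (simp add: P_def)
  have Xp: "X ^ p = X * (X * P)" and Xp1: "X ^ (p - 1) = X * P" and XL: "X ^ ((p - 1) * (q + 1)) = U * (X * P)"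
    and Xpq: "X ^ (p * q) = Q * U" and Xq1: "X ^ (q + 1) = X * Q"
    unfolding P_def Q_def U_def by (metis exps power_Suc power_add Suc_eq_plus1)+
  have Pv: "Poly (v i) = X ^ (p - i - 2) - X * P" if "i < p - 1" for i
  proof -
    have "p - 1 = (p - i - 2) + Suc i" using that by simp
    then have "(X :: complex poly) ^ (p - 1) = X ^ (p - i - 2) * (X * X ^ i)"
      by (metis power_add power_Suc)
    moreover have "Poly (v i) = X ^ (p - i - 2) - X ^ (p - i - 2) * (X * X ^ i)"
      by (simp add: v_def word_power_single Poly_append_X algebra_simps)
    ultimately show ?thesis unfolding Xp1 by simp
  qed
  define G where "G = (\<Sum>i<p - 1. X ^ (i * q) :: complex poly)"
  have G: "G * (Q - 1) = U - 1"
    unfolding G_def Q_def U_def by (rule geometric_sum_powers)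
  have "Poly ?C = P * (Poly ?W + X ^ length ?W * (P * (- 1)))"
    unfolding pad[symmetric] Poly_append_X[of "[0] \<^bold>^ (p - 2)"] Poly_append_X[of ?W]
    by (simp add: word_power_single P_def one_pCons)
  also have "\<dots> = P * Poly ?W - X ^ ((p - 2) + length ?W + (p - 2))"
    by (simp add: P_def algebra_simps power_add)
  also have "X ^ ((p - 2) + length ?W + (p - 2)) = U * P"
    unfolding pos by (simp add: U_def P_def power_add)
  finally have PW: "P * Poly ?W = Poly ?C + U * P" by simp
  have "Poly ?C * (X ^ p - 1) = (X * Q - 1) * (\<Sum>i<p - 1. X ^ (i * (q + 1)) * Poly (v i))"
    using Poly_concat_word_powers[of "p - 1" v p "q div p + 1", OF len] unfolding k Xq1 .
  also have "(\<Sum>i<p - 1. X ^ (i * (q + 1)) * Poly (v i)) =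
      (\<Sum>i<p - 1. P * X ^ (i * q) - X * P * X ^ (i * (q + 1)))"
  proof (rule sum.cong)
    fix i assume i: "i \<in> {..<p - 1}"
    then have "i * (q + 1) + (p - i - 2) = (p - 2) + i * q" by simp
    then have shift: "X ^ (i * (q + 1)) * X ^ (p - i - 2) = P * X ^ (i * q)"
      by (metis power_add P_def)
    have Pvi: "Poly (v i) = X ^ (p - i - 2) - X * P"
      using i by (intro Pv) simp
    show "X ^ (i * (q + 1)) * Poly (v i) = P * X ^ (i * q) - X * P * X ^ (i * (q + 1))"
      unfolding Pvi right_diff_distrib shift by (simp only: mult_ac)
  qed simp
  also have "\<dots> = P * G - X * P * (\<Sum>i<p - 1. X ^ (i * (q + 1)))"
    by (simp only: sum_subtractf sum_distrib_left G_def)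
  also have "(X * Q - 1) * \<dots> = (X * Q - 1) * (P * G) - X * P * ((\<Sum>i<p - 1. X ^ (i * (q + 1))) * (X * Q - 1))"
    by algebra
  also have "(\<Sum>i<p - 1. X ^ (i * (q + 1))) * (X * Q - 1) = U * (X * P) - 1"
    using geometric_sum_powers[of "X :: complex poly" "q + 1" "p - 1"] unfolding Xq1 XL .
  finally have C: "Poly ?C * (X ^ p - 1) = (X * Q - 1) * (P * G) - X * P * (U * (X * P) - 1)" .
  have "P * (Poly ?W * ((X ^ p - 1) * (X ^ q - 1))) =
      (P * Poly ?W) * (X ^ p - 1) * (Q - 1)"
    by (simp only: Q_def mult.assoc)
  also have "\<dots> = (Poly ?C * (X ^ p - 1) + U * P * (X ^ p - 1)) * (Q - 1)"
    by (simp only: PW distrib_right)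
  also have "\<dots> = (X * Q - 1) * P * (G * (Q - 1)) +
      (U * P * (X * (X * P) - 1) - X * P * (U * (X * P) - 1)) * (Q - 1)"
    unfolding C unfolding Xp by algebra
  also have "\<dots> = P * ((X ^ (p * q) - 1) * (X - 1))"
    unfolding G Xpq by algebra
  finally show "Poly ?W * ((X ^ p - 1) * (X ^ q - 1)) = (X ^ (p * q) - 1) * (X - 1)"
    by (rule mult_left_cancel[OF P0, THEN iffD1])
qed (use assms in auto)

theorem theorem4p1:
  fixes p q :: nat
  assumes "prime p" and "prime q" and "odd p" and "odd q" and "p < q"
  shows
    "([q = 1] (mod p) \<longrightarrow>
       (let v = (\<lambda>i. [0] \<^bold>^ i @ [-1] @ [0] \<^bold>^ (p - i - 2) @ [1])
        in binary_cyclotomic_word p q =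
             [1] @ concat (map (\<lambda>i. v i \<^bold>^ (q div p)) [0..<p - 1])))
     \<and>
     ([q = p - 1] (mod p) \<longrightarrow>
       (let v = (\<lambda>i. [0] \<^bold>^ (p - i - 2) @ [1] @ [0] \<^bold>^ i @ [-1])
        in binary_cyclotomic_word p q =
             [1, -1] @
             concat (map (\<lambda>i. v i \<^bold>^ (if i = 0 \<or> i = p - 2 then q div p else q div p + 1)) [0..<p - 1])
             @ [1]))"
  unfolding Let_def
  using binary_cyclotomic_word_cong_1[of p q] binary_cyclotomic_word_cong_minus_1[of p q] assms
  by blast

end
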